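(* Let $d\ge 2$ be even, and let $V_1,V_2,V_3,V_4$, $p_1,p_2,p_3,p_4$ be the data of a string segment in $AdS_{d+1}$ satisfying the causality conditions (see context), with world sheet area $A_\diamond$. Let $V(B_L^{d-2})$ be the volume of the $(d-2)$-dimensional Euclidean ball of radius $L$ (equal to $1$ for $d=2$). Then $$S^{\mathrm{uni}}(14)+S^{\mathrm{uni}}(23)-S^{\mathrm{uni}}(12)-S^{\mathrm{uni}}(34)=(-1)^{(d-2)/2}\,\frac{V(B_L^{d-2})\,A_\diamond}{4G^{(d+1)}L}.$$
   Context: $\mathbb{R}^{2,d}$ has coordinates $X^{-1},X^0,X^1,\dots,X^d$ and bilinear form $X\cdot Y=-X^{-1}Y^{-1}-X^0Y^0+\sum_{k=1}^dX^kY^k$; $X^\pm=X^1\pm X^{-1}$. $AdS_{d+1}=\{X: X\cdot X=-L^2\}$, $L>0$. A string segment is given by $V_1\in AdS_{d+1}$ and null vectors $p_1,p_4\in\mathbb{R}^{2,d}$ with $p_1\cdot V_1=p_4\cdot V_1=0$. Its world sheet is the image of $$X(\sigma^-,\sigma^+)=\frac{L^2+\sigma^-\sigma^+\frac12 p_1\cdot p_4}{L^2-\sigma^-\sigma^+\frac12 p_1\cdot p_4}V_1+L^2\frac{\sigma^-p_1+\sigma^+p_4}{L^2-\sigma^-\sigma^+\frac12 p_1\cdot p_4},\qquad \sigma^\pm\in[0,1],$$ with vertices $V_2=X(1,0)=V_1+p_1$, $V_4=X(0,1)=V_1+p_4$, $V_3=X(1,1)$, and $p_2=V_3-V_2$,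 $p_3=V_3-V_4$. $A_\diamond=\int_0^1\int_0^1\sqrt{-\det(\partial_\alpha X\cdot\partial_\beta X)}\,d\sigma^-d\sigma^+$ is its Lorentzian area. Boundary points (assuming $p_i^-\neq0$): $x_i=\frac{L}{p_i^-}(p_i^0,p_i^2,\dots,p_i^d)\in\mathbb{R}^{d-1,1}$, with time component $t_i=Lp_i^0/p_i^-$, where $\mathbb{R}^{d-1,1}$ has product $x\bullet y=-x^0y^0+\sum_{k=1}^{d-1}x^ky^k$. Put $r_{ij}^2=-\frac14(x_i-x_j)\bullet(x_i-x_j)$. Causality conditions: $V_i^->0$ for all $i$; $p_1\cdot p_4<0$; $(x_i-x_j)\bullet(x_i-x_j)<0$ for the neighbouring edges $(ij)=(12),(23),(34),(14)$; and $t_1<t_3<t_4<t_2$. $S^{\mathrm{uni}}(ij)$ is the universal (logarithmic in the cutoff $\delta>0$) term of the Ryu–Takayanagi entropy $\mathcal{A}/(4G^{(d+1)})$ of the spherical boundary region whose causal diamond has tips $x_i,x_j$, where $\mathcal{A}$ is the regularized area (cutoff $z>\delta$ in Poincaré coordinates) of the minimal surface $\{X\in AdS_{d+1}:p_i\cdot X=p_j\cdot X=0\}$ and $G^{(d+1)}>0$ is Newton's constant. Explicitly, $$S^{\mathrm{uni}}(ij)=\frac{(-2\pi)^{(d-2)/2}L^{d-1}}{4G^{(d+1)}(d-2)!!}\log\frac{r_{ij}^2}{\delta^2},\qquad 0!!=1.$$ *)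

theory Defs
  imports "HOL-Analysis.Analysis"
begin

text \<open>
  The space \<open>\<real>\<^sup>2\<^sup>,\<^sup>d\<close> with coordinates \<open>X\<^sup>-\<^sup>1, X\<^sup>0, X\<^sup>1, \<dots>, X\<^sup>d\<close>: real functions on the integers
  that vanish outside the index range \<open>-1, \<dots>, d\<close>, so that \<open>d\<close> can be an ordinary variable.
\<close>

definition R2 :: "nat \<Rightarrow> (int \<Rightarrow> real) set" where
  "R2 d = {X. \<forall>k. k \<notin> {-1..int d} \<longrightarrow> X k = 0}"

definition ip :: "nat \<Rightarrow> (int \<Rightarrow> real) \<Rightarrow> (int \<Rightarrow> real) \<Rightarrow> real" where
  "ip d X Y = - X (-1) * Y (-1) - X 0 * Y 0 + (\<Sum>k\<in>{1..int d}. X k * Y k)"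

definition minus_comp :: "(int \<Rightarrow> real) \<Rightarrow> real" where
  "minus_comp X = X 1 - X (-1)"

definition AdS :: "nat \<Rightarrow> real \<Rightarrow> (int \<Rightarrow> real) set" where
  "AdS d L = {X \<in> R2 d. ip d X X = - (L\<^sup>2)}"

definition null_vectors :: "nat \<Rightarrow> (int \<Rightarrow> real) set" where
  "null_vectors d = {X \<in> R2 d. ip d X X = 0}"

text \<open>
  In the following, \<open>V\<close>, \<open>p\<close>, \<open>q\<close> stand for \<open>V\<^sub>1\<close>, \<open>p\<^sub>1\<close>, \<open>p\<^sub>4\<close>, and \<open>s\<close>, \<open>t\<close> for \<open>\<sigma>\<^sup>-\<close>, \<open>\<sigma>\<^sup>+\<close>.
  The formula is used for all real \<open>s\<close>, \<open>t\<close>, so that the partial derivatives also make sense on the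
  boundary of the unit square.
\<close>

definition world_sheet ::
  "nat \<Rightarrow> real \<Rightarrow> (int \<Rightarrow> real) \<Rightarrow> (int \<Rightarrow> real) \<Rightarrow> (int \<Rightarrow> real) \<Rightarrow> real \<Rightarrow> real \<Rightarrow> int \<Rightarrow> real" where
  "world_sheet d L V p q s t = (\<lambda>k.
     (L\<^sup>2 + s * t * (1/2) * ip d p q) / (L\<^sup>2 - s * t * (1/2) * ip d p q) * V k
     + L\<^sup>2 * ((s * p k + t * q k) / (L\<^sup>2 - s * t * (1/2) * ip d p q)))"

definition partial_s :: "(real \<Rightarrow> real \<Rightarrow> int \<Rightarrow> real) \<Rightarrow> real \<Rightarrow> real \<Rightarrow> int \<Rightarrow> real" where
  "partial_s X s t = (\<lambda>k. deriv (\<lambda>u. X u t k) s)"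

definition partial_t :: "(real \<Rightarrow> real \<Rightarrow> int \<Rightarrow> real) \<Rightarrow> real \<Rightarrow> real \<Rightarrow> int \<Rightarrow> real" where
  "partial_t X s t = (\<lambda>k. deriv (\<lambda>u. X s u k) t)"

definition induced_metric ::
  "nat \<Rightarrow> (real \<Rightarrow> real \<Rightarrow> int \<Rightarrow> real) \<Rightarrow> real \<Rightarrow> real \<Rightarrow> real ^ 2 ^ 2" where
  "induced_metric d X s t = vector
     [vector [ip d (partial_s X s t) (partial_s X s t), ip d (partial_s X s t) (partial_t X s t)],
      vector [ip d (partial_t X s t) (partial_s X s t), ip d (partial_t X s t) (partial_t X s t)]]"

definition lorentzian_area :: "nat \<Rightarrow> (real \<Rightarrow> real \<Rightarrow> int \<Rightarrow> real) \<Rightarrow> real" where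
  "lorentzian_area d X =
     integral {0..1} (\<lambda>t. integral {0..1} (\<lambda>s. sqrt (- det (induced_metric d X s t))))"

text \<open>Vertices and edges are indexed by \<open>1, \<dots>, 4\<close>; other values of \<open>V\<close> and \<open>p\<close> play no role.\<close>

definition string_segment ::
  "nat \<Rightarrow> real \<Rightarrow> (nat \<Rightarrow> int \<Rightarrow> real) \<Rightarrow> (nat \<Rightarrow> int \<Rightarrow> real) \<Rightarrow> bool" where
  "string_segment d L V p \<longleftrightarrow>
     V 1 \<in> AdS d L \<and> p 1 \<in> null_vectors d \<and> p 4 \<in> null_vectors d \<and>
     ip d (p 1) (V 1) = 0 \<and> ip d (p 4) (V 1) = 0 \<and>
     V 2 = world_sheet d L (V 1) (p 1) (p 4) 1 0 \<and>
     V 4 = world_sheet d L (V 1) (p 1) (p 4) 0 1 \<and>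
     V 3 = world_sheet d L (V 1) (p 1) (p 4) 1 1 \<and>
     p 2 = (\<lambda>k. V 3 k - V 2 k) \<and> p 3 = (\<lambda>k. V 3 k - V 4 k)"

text \<open>
  Vectors of \<open>\<real>\<^sup>d\<^sup>-\<^sup>1\<^sup>,\<^sup>1\<close> have components \<open>0, \<dots>, d - 1\<close>, the time component being the one with index \<open>0\<close>.
  The spatial component \<open>k\<close> of a boundary point comes from the component \<open>k + 1\<close> of the ambient vector.
\<close>

definition boundary_point :: "real \<Rightarrow> (int \<Rightarrow> real) \<Rightarrow> nat \<Rightarrow> real" where
  "boundary_point L p k = L / minus_comp p * (if k = 0 then p 0 else p (int k + 1))"

definition mink :: "nat \<Rightarrow> (nat \<Rightarrow> real) \<Rightarrow> (nat \<Rightarrow> real) \<Rightarrow> real" where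
  "mink d x y = - x 0 * y 0 + (\<Sum>k=1..d-1. x k * y k)"

definition interval_sq :: "nat \<Rightarrow> (nat \<Rightarrow> real) \<Rightarrow> (nat \<Rightarrow> real) \<Rightarrow> real" where
  "interval_sq d x y = mink d (\<lambda>k. x k - y k) (\<lambda>k. x k - y k)"

definition causality_conditions ::
  "nat \<Rightarrow> real \<Rightarrow> (nat \<Rightarrow> int \<Rightarrow> real) \<Rightarrow> (nat \<Rightarrow> int \<Rightarrow> real) \<Rightarrow> bool" where
  "causality_conditions d L V p \<longleftrightarrow>
     (\<forall>i\<in>{1..4}. minus_comp (V i) > 0) \<and>
     ip d (p 1) (p 4) < 0 \<and>
     (\<forall>(i, j)\<in>{(1, 2), (2, 3), (3, 4), (1, 4)}.
        interval_sq d (boundary_point L (p i)) (boundary_point L (p j)) < 0) \<and>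
     boundary_point L (p 1) 0 < boundary_point L (p 3) 0 \<and>
     boundary_point L (p 3) 0 < boundary_point L (p 4) 0 \<and>
     boundary_point L (p 4) 0 < boundary_point L (p 2) 0"

fun double_fact :: "nat \<Rightarrow> nat" where
  "double_fact 0 = 1"
| "double_fact (Suc 0) = 1"
| "double_fact (Suc (Suc n)) = Suc (Suc n) * double_fact n"

text \<open>
  The logarithmic term in the cutoff \<open>\<delta>\<close> of the Ryu--Takayanagi entropy (regularized minimal area
  over \<open>4 G\<close>) of the spherical region whose causal diamond has tips \<open>x\<close> and \<open>y\<close>. The sphere has
  radius \<open>r\<close> with \<open>r\<^sup>2 = - interval_sq d x y / 4\<close>, and the coefficient is the one of \<open>log (r\<^sup>2 / \<delta>\<^sup>2)\<close>
  in the expansion of the area of the hemisphere above it with \<open>z > \<delta>\<close>, for even \<open>d\<close>. The scale \<open>r\<close>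
  inside the logarithm fixes which finite term is counted as part of the universal term.
\<close>

definition S_uni ::
  "nat \<Rightarrow> real \<Rightarrow> real \<Rightarrow> real \<Rightarrow> (nat \<Rightarrow> real) \<Rightarrow> (nat \<Rightarrow> real) \<Rightarrow> real" where
  "S_uni d L G \<delta> x y =
     (- 2 * pi) ^ ((d - 2) div 2) * L ^ (d - 1) / (4 * G * real (double_fact (d - 2)))
     * ln ((- (1/4) * interval_sq d x y) / \<delta>\<^sup>2)"

text \<open>
  The Euclidean space is a product of copies of the real line rather than a type, because its
  dimension \<open>n\<close> varies and may be \<open>0\<close>; in that case the product has one point, of measure \<open>1\<close>.
\<close>

definition ball_volume :: "nat \<Rightarrow> real \<Rightarrow> real" where
  "ball_volume n r =
     measure (\<Pi>\<^sub>M i\<in>{..<n}. lborel)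
       {x \<in> space (\<Pi>\<^sub>M i\<in>{..<n}. lborel). sqrt (\<Sum>i<n. (x i)\<^sup>2) \<le> r}"

end

theory Submission
  imports Defs
begin

text \<open>
  For null vectors \<open>a\<close>, \<open>b\<close> one has \<open>(x\<^sub>a - x\<^sub>b)\<^sup>2 = -2 L\<^sup>2 (a \<cdot> b) / (a\<^sup>- b\<^sup>-)\<close>, so the components
  \<open>p\<^sub>i\<^sup>-\<close> cancel in the alternating sum of logarithms, which becomes the logarithm of the cross
  ratio \<open>(p\<^sub>1 \<cdot> p\<^sub>4) (p\<^sub>2 \<cdot> p\<^sub>3) / ((p\<^sub>1 \<cdot> p\<^sub>2) (p\<^sub>3 \<cdot> p\<^sub>4)) = (1 - m / L\<^sup>2)\<^sup>2\<close> with \<open>m = p\<^sub>1 \<cdot> p\<^sub>4 / 2\<close>.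
  The parameters of the world sheet are light-cone coordinates, and its area density is
  \<open>-2 m L\<^sup>4 / (L\<^sup>2 - \<sigma>\<^sup>- \<sigma>\<^sup>+ m)\<^sup>2\<close>, whose integral is \<open>2 L\<^sup>2 log (1 - m / L\<^sup>2)\<close>. For even \<open>d\<close> the
  coefficient of the entropy is a ball volume because \<open>(d - 2)!! = 2\<^sup>k k!\<close> with \<open>d - 2 = 2 k\<close>.
\<close>

section \<open>The bilinear form and light-cone frames\<close>

lemma ip_commute: "ip d X Y = ip d Y X"
  by (simp add: ip_def mult.commute)

lemma ip_lin_left:
  "ip d (\<lambda>k. a * X k + b * Y k + c * Z k) W = a * ip d X W + b * ip d Y W + c * ip d Z W"
  by (simp add: ip_def algebra_simps sum.distrib sum_distrib_left)

lemma ip_lin_right: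
  "ip d W (\<lambda>k. a * X k + b * Y k + c * Z k) = a * ip d W X + b * ip d W Y + c * ip d W Z"
  unfolding ip_commute[of d W] by (rule ip_lin_left)

text \<open>\<open>p\<close> and \<open>q\<close> are null and tangent to anti-de Sitter space at
  \<open>V\<close>. This fixes the Gram matrix of the three vectors up to \<open>ip d p q\<close>,
  so inner products of vectors in their span depend only on coefficients, \<open>L\<close> and that
  number.\<close>

definition light_cone_frame ::
  "nat \<Rightarrow> real \<Rightarrow> (int \<Rightarrow> real) \<Rightarrow> (int \<Rightarrow> real) \<Rightarrow> (int \<Rightarrow> real) \<Rightarrow> bool" where
  "light_cone_frame d L V p q \<longleftrightarrow>
     ip d V V = - (L\<^sup>2) \<and> ip d p p = 0 \<and> ip d q q = 0 \<and> ip d p V = 0 \<and> ip d q V = 0"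

lemma ip_light_cone_frame:
  assumes "light_cone_frame d L V p q"
  shows "ip d (\<lambda>k. a * V k + b * p k + c * q k) (\<lambda>k. a' * V k + b' * p k + c' * q k)
       = - (L\<^sup>2) * a * a' + ip d p q * (b * c' + c * b')"
proof -
  have frame: "ip d V V = - (L\<^sup>2)" "ip d p p = 0" "ip d q q = 0"
    "ip d p V = 0" "ip d q V = 0"
    using assms by (simp_all add: light_cone_frame_def)
  show ?thesis
    unfolding ip_lin_left ip_lin_right
    by (simp add: frame ip_commute[of d V p] ip_commute[of d V q] ip_commute[of d q p] algebra_simps)
qed

section \<open>Intervals between boundary points\<close>

text \<open>Write \<open>P\<close> for the part of the form without the components \<open>-1\<close>
  and \<open>1\<close>. Nullity gives \<open>P a a = - a^+ a^-\<close>, and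
  \<open>ip d a b = P a b + (a^+ b^- + a^- b^+) / 2\<close>; rescaling by \<open>L / a^-\<close> and
  \<open>L / b^-\<close> makes the two expressions agree.\<close>

lemma interval_sq_boundary_point:
  assumes "d \<ge> 1" and "ip d a a = 0" and "ip d b b = 0"
    and "minus_comp a \<noteq> 0" and "minus_comp b \<noteq> 0"
  shows "interval_sq d (boundary_point L a) (boundary_point L b)
       = - 2 * L\<^sup>2 * ip d a b / (minus_comp a * minus_comp b)"
proof -
  define P where "P f g = - f 0 * g 0 + (\<Sum>k\<in>{2..int d}. f k * g k)" for f g :: "int \<Rightarrow> real"
  have split: "ip d f g = P f g + f 1 * g 1 - f (-1) * g (-1)" for f g
  proof -
    have "{1..int d} = insert 1 {2..int d}"
      using \<open>d \<ge> 1\<close> by auto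
    then show ?thesis
      by (simp add: ip_def P_def)
  qed
  define u where "u = L / minus_comp a"
  define v where "v = L / minus_comp b"
  \<comment> \<open>The natural indices \<open>1..d-1\<close> of the boundary are the integer
    indices \<open>2..d\<close> of the ambient space, since the component \<open>1\<close> is
    absorbed into \<open>minus_comp\<close>.\<close>
  have shift: "(\<Sum>k=1..d-1. (u * a (int k + 1) - v * b (int k + 1)) *
          (u * a (int k + 1) - v * b (int k + 1)))
      = (\<Sum>k\<in>{2..int d}. (u * a k - v * b k) * (u * a k - v * b k))"
    by (rule sum.reindex_bij_witness[of _ "\<lambda>k. nat (k - 1)" "\<lambda>k. int k + 1"]) auto
  have "interval_sq d (boundary_point L a) (boundary_point L b)
      = P (\<lambda>k. u * a k - v * b k) (\<lambda>k. u * a k - v * b k)"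
    unfolding P_def shift[symmetric]
    by (simp add: interval_sq_def mink_def boundary_point_def u_def v_def)
  also have "\<dots> = u\<^sup>2 * P a a + v\<^sup>2 * P b b - 2 * u * v * P a b"
    by (simp add: P_def power2_eq_square algebra_simps sum.distrib sum_subtractf sum_distrib_left)
  also have "\<dots> = - 2 * L\<^sup>2 * ip d a b / (minus_comp a * minus_comp b)"
  proof -
    have Paa: "P a a = (a (-1))\<^sup>2 - (a 1)\<^sup>2" and Pbb: "P b b = (b (-1))\<^sup>2 - (b 1)\<^sup>2"
      and Pab: "P a b = ip d a b - a 1 * b 1 + a (-1) * b (-1)"
      using split[of a a] split[of b b] split[of a b] assms
      by (simp_all add: power2_eq_square)
    have "a 1 - a (-1) \<noteq> 0" "b 1 - b (-1) \<noteq> 0"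
      using assms by (simp_all add: minus_comp_def)
    then show ?thesis
      unfolding u_def v_def minus_comp_def Paa Pbb Pab
      by (simp add: divide_simps) (simp add: power2_eq_square algebra_simps)
  qed
  finally show ?thesis .
qed

section \<open>Area of the world sheet\<close>

lemma world_sheet_eq_divide:
  fixes d :: nat and V p q :: "int \<Rightarrow> real"
  defines "m \<equiv> ip d p q / 2"
  shows "world_sheet d L V p q s t k
       = ((L\<^sup>2 + s * t * m) * V k + L\<^sup>2 * (s * p k + t * q k)) / (L\<^sup>2 - s * t * m)"
proof -
  have "s * t * (1/2) * ip d p q = s * t * m"
    by (simp add: m_def)
  then show ?thesis
    unfolding world_sheet_def
    by (simp only: times_divide_eq_right times_divide_eq_left add_divide_distrib[symmetric])
qed

text \<open>The quotient rule, sorted by frame vectors: both tangent vectors stay in the span of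
  \<open>V\<close>, \<open>p\<close>, \<open>q\<close>, so \<open>ip_light_cone_frame\<close> yields
  the induced metric.\<close>

lemma partial_world_sheet:
  fixes d :: nat and V p q :: "int \<Rightarrow> real"
  defines "m \<equiv> ip d p q / 2"
  assumes "L\<^sup>2 - s * t * m \<noteq> 0"
  defines "c \<equiv> L\<^sup>2 / (L\<^sup>2 - s * t * m)\<^sup>2"
  shows "partial_s (world_sheet d L V p q) s t
       = (\<lambda>k. (c * (2 * m * t)) * V k + (c * L\<^sup>2) * p k + (c * (m * t\<^sup>2)) * q k)" (is ?S)
    and "partial_t (world_sheet d L V p q) s t
       = (\<lambda>k. (c * (2 * m * s)) * V k + (c * (m * s\<^sup>2)) * p k + (c * L\<^sup>2) * q k)" (is ?T)
proof -
  note sheet = world_sheet_eq_divide[of d L V p q, folded m_def]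
  show ?S
  proof
    fix k
    have "((\<lambda>u. world_sheet d L V p q u t k) has_field_derivative
        (c * (2 * m * t)) * V k + (c * L\<^sup>2) * p k + (c * (m * t\<^sup>2)) * q k) (at s)"
      unfolding sheet c_def using assms(2)
      by (auto intro!: derivative_eq_intros simp: add_divide_distrib[symmetric])
        (simp add: power2_eq_square power4_eq_xxxx algebra_simps)
    then show "partial_s (world_sheet d L V p q) s t k
        = (c * (2 * m * t)) * V k + (c * L\<^sup>2) * p k + (c * (m * t\<^sup>2)) * q k"
      by (simp add: partial_s_def DERIV_imp_deriv)
  qed
  show ?T
  proof
    fix k
    have "((\<lambda>u. world_sheet d L V p q s u k) has_field_derivative
        (c * (2 * m * s)) * V k + (c * (m * s\<^sup>2)) * p k + (c * L\<^sup>2) * q k) (at t)"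
      unfolding sheet c_def using assms(2)
      by (auto intro!: derivative_eq_intros simp: add_divide_distrib[symmetric])
        (simp add: power2_eq_square power4_eq_xxxx algebra_simps)
    then show "partial_t (world_sheet d L V p q) s t k
        = (c * (2 * m * s)) * V k + (c * (m * s\<^sup>2)) * p k + (c * L\<^sup>2) * q k"
      by (simp add: partial_t_def DERIV_imp_deriv)
  qed
qed

text \<open>Both coordinate directions are null, so the metric is purely off-diagonal and minus its
  determinant is the square of the mixed entry. That entry contains the perfect square
  \<open>(L^2 - s * t * m)^2\<close>, which lowers the power of the denominator.\<close>

lemma area_density_world_sheet:
  fixes d :: nat and V p q :: "int \<Rightarrow> real"
  assumes frame: "light_cone_frame d L V p q"
  defines "m \<equiv> ip d p q / 2"
  assumes N: "L\<^sup>2 - s * t * m \<noteq> 0"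
  shows "sqrt (- det (induced_metric d (world_sheet d L V p q) s t))
       = 2 * \<bar>m\<bar> * L ^ 4 / (L\<^sup>2 - s * t * m)\<^sup>2"
proof -
  define N where "N = L\<^sup>2 - s * t * m"
  define c where "c = L\<^sup>2 / N\<^sup>2"
  let ?S = "partial_s (world_sheet d L V p q) s t"
  let ?T = "partial_t (world_sheet d L V p q) s t"
  note partials = partial_world_sheet[of L s t d p q V, folded m_def, OF N, folded N_def c_def]
  have m: "ip d p q = 2 * m"
    by (simp add: m_def)
  have SS: "ip d ?S ?S = 0" and TT: "ip d ?T ?T = 0"
    unfolding partials ip_light_cone_frame[OF frame] m
    by (simp_all add: power2_eq_square algebra_simps)
  have "ip d ?S ?T = 2 * m * (c * N)\<^sup>2"
    unfolding partials ip_light_cone_frame[OF frame] m N_def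
    by (simp add: power2_eq_square algebra_simps)
  also have "\<dots> = 2 * m * L ^ 4 / N\<^sup>2"
    using N by (simp add: c_def N_def[symmetric] power2_eq_square power4_eq_xxxx)
  finally have ST: "ip d ?S ?T = 2 * m * L ^ 4 / N\<^sup>2" .
  then have "ip d ?T ?S = 2 * m * L ^ 4 / N\<^sup>2"
    by (simp add: ip_commute)
  then have "- det (induced_metric d (world_sheet d L V p q) s t) = (2 * m * L ^ 4 / N\<^sup>2)\<^sup>2"
    by (simp add: induced_metric_def det_2 SS TT ST power2_eq_square)
  then show ?thesis
    by (simp add: N_def abs_mult)
qed

lemma lorentzian_area_world_sheet:
  fixes d :: nat and V p q :: "int \<Rightarrow> real"
  assumes "L > 0" and frame: "light_cone_frame d L V p q"
  defines "m \<equiv> ip d p q / 2"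
  assumes "m < 0"
  shows "lorentzian_area d (world_sheet d L V p q) = 2 * L\<^sup>2 * ln (1 - m / L\<^sup>2)"
proof -
  \<comment> \<open>Negativity of \<open>m\<close> excludes poles on the unit square.\<close>
  have pos: "L\<^sup>2 - s * t * m > 0" if "s \<ge> 0" "t \<ge> 0" for s t
  proof -
    have "s * t * m \<le> 0"
      using that \<open>m < 0\<close> by (simp add: mult_nonneg_nonpos)
    moreover have "L\<^sup>2 > 0"
      using \<open>L > 0\<close> by simp
    ultimately show ?thesis
      by linarith
  qed
  have inner: "integral {0..1} (\<lambda>s. sqrt (- det (induced_metric d (world_sheet d L V p q) s t)))
      = - 2 * m * L\<^sup>2 / (L\<^sup>2 - t * m)" if "t \<in> {0..1}" for t
  proof (rule integral_unique)
    \<comment> \<open>This antiderivative vanishes at \<open>s = 0\<close> and involves no division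
      by \<open>t\<close>, so \<open>t = 0\<close> needs no separate case. Its endpoint values are
      left unsimplified to match the rule.\<close>
    have "((\<lambda>s. - 2 * m * L ^ 4 / (L\<^sup>2 - s * t * m)\<^sup>2) has_integral
        - 2 * m * L\<^sup>2 * 1 / (L\<^sup>2 - 1 * t * m) - (- 2 * m * L\<^sup>2 * 0 / (L\<^sup>2 - 0 * t * m))) {0..1}"
    proof (rule fundamental_theorem_of_calculus)
      fix s :: real assume "s \<in> {0..1}"
      then have "L\<^sup>2 - s * t * m > 0"
        using pos that by simp
      then show "((\<lambda>s. - 2 * m * L\<^sup>2 * s / (L\<^sup>2 - s * t * m)) has_vector_derivative
          - 2 * m * L ^ 4 / (L\<^sup>2 - s * t * m)\<^sup>2) (at s within {0..1})"
        unfolding has_real_derivative_iff_has_vector_derivative[symmetric]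
        by (auto intro!: derivative_eq_intros)
          (simp add: power2_eq_square power4_eq_xxxx algebra_simps)
    qed simp
    then have "((\<lambda>s. - 2 * m * L ^ 4 / (L\<^sup>2 - s * t * m)\<^sup>2) has_integral
        - 2 * m * L\<^sup>2 / (L\<^sup>2 - t * m)) {0..1}"
      by simp
    then show "((\<lambda>s. sqrt (- det (induced_metric d (world_sheet d L V p q) s t))) has_integral
        - 2 * m * L\<^sup>2 / (L\<^sup>2 - t * m)) {0..1}"
    proof (rule has_integral_eq[rotated])
      fix s :: real assume "s \<in> {0..1}"
      then have "L\<^sup>2 - s * t * m \<noteq> 0"
        using pos[of s t] that by simp
      from area_density_world_sheet[OF frame, folded m_def, OF this]
      show "- 2 * m * L ^ 4 / (L\<^sup>2 - s * t * m)\<^sup>2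
          = sqrt (- det (induced_metric d (world_sheet d L V p q) s t))"
        using \<open>m < 0\<close> by simp
    qed
  qed
  have "((\<lambda>t. - 2 * m * L\<^sup>2 / (L\<^sup>2 - t * m)) has_integral
      2 * L\<^sup>2 * ln (L\<^sup>2 - 1 * m) - 2 * L\<^sup>2 * ln (L\<^sup>2 - 0 * m)) {0..1}"
  proof (rule fundamental_theorem_of_calculus)
    fix t :: real assume "t \<in> {0..1}"
    then have "L\<^sup>2 - t * m > 0"
      using pos[of 1 t] by simp
    then show "((\<lambda>t. 2 * L\<^sup>2 * ln (L\<^sup>2 - t * m)) has_vector_derivative
        - 2 * m * L\<^sup>2 / (L\<^sup>2 - t * m)) (at t within {0..1})"
      unfolding has_real_derivative_iff_has_vector_derivative[symmetric]
      by (auto intro!: derivative_eq_intros)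
  qed simp
  from integral_unique[OF this] have "integral {0..1} (\<lambda>t. - 2 * m * L\<^sup>2 / (L\<^sup>2 - t * m))
      = 2 * L\<^sup>2 * (ln (L\<^sup>2 - m) - ln (L\<^sup>2))"
    by (simp only: right_diff_distrib mult_1_left mult_zero_left diff_zero)
  also have "ln (L\<^sup>2 - m) - ln (L\<^sup>2) = ln (1 - m / L\<^sup>2)"
  proof -
    have "L\<^sup>2 - m > 0"
      using pos[of 1 1] by simp
    then have "ln (L\<^sup>2 - m) - ln (L\<^sup>2) = ln ((L\<^sup>2 - m) / L\<^sup>2)"
      using \<open>L > 0\<close> by (simp add: ln_div)
    then show ?thesis
      using \<open>L > 0\<close> by (simp add: diff_divide_distrib)
  qed
  also have "integral {0..1} (\<lambda>t. - 2 * m * L\<^sup>2 / (L\<^sup>2 - t * m))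
      = lorentzian_area d (world_sheet d L V p q)"
    unfolding lorentzian_area_def by (intro integral_cong) (simp only: inner)
  finally show ?thesis .
qed

section \<open>Double factorials and ball volumes\<close>

lemma double_fact_even: "double_fact (2 * k) = 2 ^ k * fact k"
  by (induction k) (simp_all add: algebra_simps)

lemma ball_volume_even:
  assumes "r > 0"
  shows "ball_volume (2 * k) r = pi ^ k * r ^ (2 * k) / fact k"
proof -
  let ?M = "\<Pi>\<^sub>M i\<in>{..<2 * k}. (lborel :: real measure)"
  \<comment> \<open>The intersection form is the one measured by
    \<open>emeasure_cball_aux\<close>.\<close>
  have "{x \<in> space ?M. sqrt (\<Sum>i<2 * k. (x i)\<^sup>2) \<le> r}
      = {x. sqrt (\<Sum>i<2 * k. (x i)\<^sup>2) \<le> r} \<inter> space ?M"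
    by blast
  then have "emeasure ?M {x \<in> space ?M. sqrt (\<Sum>i<2 * k. (x i)\<^sup>2) \<le> r}
      = ennreal (unit_ball_vol (real (2 * k)) * r ^ (2 * k))"
    using emeasure_cball_aux[of "{..<2 * k}" r] assms by simp
  then have "ball_volume (2 * k) r = unit_ball_vol (real (2 * k)) * r ^ (2 * k)"
    using assms by (simp add: ball_volume_def measure_def)
  then show ?thesis
    unfolding unit_ball_vol_even by simp
qed

section \<open>Edges and their cross ratio\<close>

text \<open>The edges \<open>p3\<close> and \<open>p2\<close> are multiples of the \<open>s\<close>-
  and \<open>t\<close>-derivatives of the sheet at \<open>(1, 1)\<close>, hence null. The factor
  \<open>1 - m / L^2\<close> comes from their denominator.\<close>

lemma ip_world_sheet_edges:
  fixes d :: nat and V p q :: "int \<Rightarrow> real"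
  assumes "L > 0" and frame: "light_cone_frame d L V p q"
  defines "m \<equiv> ip d p q / 2"
  assumes N: "L\<^sup>2 - m \<noteq> 0"
  defines "X \<equiv> world_sheet d L V p q"
  defines "p2 \<equiv> \<lambda>k. X 1 1 k - X 1 0 k" and "p3 \<equiv> \<lambda>k. X 1 1 k - X 0 1 k"
  shows "ip d p2 p2 = 0" and "ip d p3 p3 = 0" and "ip d p2 p3 = ip d p q"
    and "ip d p p2 = ip d p q / (1 - m / L\<^sup>2)"
    and "ip d p3 q = ip d p q / (1 - m / L\<^sup>2)"
proof -
  define c where "c = 1 / (L\<^sup>2 - m)"
  have cN: "c\<^sup>2 * (L\<^sup>2 - m)\<^sup>2 = 1"
    using N by (simp add: c_def field_simps)
  have m: "ip d p q = 2 * m"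
    by (simp add: m_def)
  have p2: "p2 = (\<lambda>k. (c * (2 * m)) * V k + (c * m) * p k + (c * L\<^sup>2) * q k)"
    and p3: "p3 = (\<lambda>k. (c * (2 * m)) * V k + (c * L\<^sup>2) * p k + (c * m) * q k)"
  proof -
    note sheet = world_sheet_eq_divide[of d L V p q, folded m_def X_def]
    have X11: "X 1 1 k = c * ((L\<^sup>2 + m) * V k + L\<^sup>2 * (p k + q k))" for k
      by (simp add: sheet c_def)
    have "X 1 0 k = V k + p k" "X 0 1 k = V k + q k" for k
      using \<open>L > 0\<close> by (simp_all add: sheet add_divide_distrib)
    \<comment> \<open>Inserting this factor \<open>1\<close> puts all vertices over one denominator,
      so their differences need only ring arithmetic.\<close>
    moreover have "v = c * (L\<^sup>2 - m) * v" for v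
      using N by (simp add: c_def)
    ultimately have X10: "X 1 0 k = c * (L\<^sup>2 - m) * (V k + p k)"
      and X01: "X 0 1 k = c * (L\<^sup>2 - m) * (V k + q k)" for k
      by metis+
    show "p2 = (\<lambda>k. (c * (2 * m)) * V k + (c * m) * p k + (c * L\<^sup>2) * q k)"
      and "p3 = (\<lambda>k. (c * (2 * m)) * V k + (c * L\<^sup>2) * p k + (c * m) * q k)"
      unfolding p2_def p3_def X11 X10 X01 by (simp_all add: algebra_simps)
  qed
  note ip_frame = ip_light_cone_frame[OF frame]
  show "ip d p2 p2 = 0" "ip d p3 p3 = 0"
    unfolding p2 p3 ip_frame m by (simp_all add: power2_eq_square algebra_simps)
  have "ip d p2 p3 = 2 * m * (c\<^sup>2 * (L\<^sup>2 - m)\<^sup>2)"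
    unfolding p2 p3 ip_frame m by (simp add: power2_eq_square algebra_simps)
  then show "ip d p2 p3 = ip d p q"
    by (simp add: cN m)
  have c: "c * L\<^sup>2 = 1 / (1 - m / L\<^sup>2)"
    using N \<open>L > 0\<close> by (simp add: c_def field_simps)
  have "ip d p p2 = 2 * m * (c * L\<^sup>2)"
    unfolding p2 using ip_frame[of 0 1 0 "c * (2 * m)" "c * m" "c * L\<^sup>2"] by (simp add: m)
  then show "ip d p p2 = ip d p q / (1 - m / L\<^sup>2)"
    by (simp add: c m)
  have "ip d p3 q = 2 * m * (c * L\<^sup>2)"
    unfolding p3 using ip_frame[of "c * (2 * m)" "c * L\<^sup>2" "c * m" 0 0 1] by (simp add: m)
  then show "ip d p3 q = ip d p q / (1 - m / L\<^sup>2)"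
    by (simp add: c m)
qed

text \<open>Each index occurs once in the pairs 14, 23 and once in 12, 34, so the factors
  \<open>minus_comp (a i)\<close> cancel. The two neighbouring products divided by
  \<open>\<kappa>\<close> leave \<open>\<kappa>^2\<close>.\<close>

lemma ln_interval_sq_cross_ratio:
  fixes d :: nat and L \<delta> \<kappa> :: real and a :: "nat \<Rightarrow> int \<Rightarrow> real"
  defines "I \<equiv> \<lambda>i j. interval_sq d (boundary_point L (a i)) (boundary_point L (a j))"
  assumes "d \<ge> 1" and "\<delta> > 0" and "\<kappa> > 0"
    and "\<And>i. i \<in> {1..4} \<Longrightarrow> ip d (a i) (a i) = 0 \<and> minus_comp (a i) \<noteq> 0"
    and neg: "I 1 2 < 0" "I 2 3 < 0" "I 3 4 < 0" "I 1 4 < 0"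
    and "ip d (a 2) (a 3) = ip d (a 1) (a 4)"
    and "ip d (a 1) (a 2) = ip d (a 1) (a 4) / \<kappa>"
    and "ip d (a 3) (a 4) = ip d (a 1) (a 4) / \<kappa>"
  shows "ln (- (1/4) * I 1 4 / \<delta>\<^sup>2) + ln (- (1/4) * I 2 3 / \<delta>\<^sup>2)
       - ln (- (1/4) * I 1 2 / \<delta>\<^sup>2) - ln (- (1/4) * I 3 4 / \<delta>\<^sup>2) = 2 * ln \<kappa>"
proof -
  have I: "I i j = - 2 * L\<^sup>2 * ip d (a i) (a j) / (minus_comp (a i) * minus_comp (a j))"
    if "i \<in> {1..4}" "j \<in> {1..4}" for i j
    unfolding I_def using interval_sq_boundary_point[of d "a i" "a j" L] assms that by blast
  have nz: "minus_comp (a 1) \<noteq> 0" "minus_comp (a 2) \<noteq> 0"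
    "minus_comp (a 3) \<noteq> 0" "minus_comp (a 4) \<noteq> 0"
    using assms(5) by simp_all
  have "I 1 4 * I 2 3 = \<kappa>\<^sup>2 * (I 1 2 * I 3 4)"
    using nz \<open>\<kappa> > 0\<close> by (simp add: I assms(10-12) field_simps power2_eq_square del: One_nat_def)
  then have "ln ((- I 1 4) * (- I 2 3)) = ln (\<kappa>\<^sup>2 * ((- I 1 2) * (- I 3 4)))"
    by simp
  moreover have "ln ((- I 1 4) * (- I 2 3)) = ln (- I 1 4) + ln (- I 2 3)"
    using neg by (intro ln_mult_pos) auto
  moreover have "ln (\<kappa>\<^sup>2 * ((- I 1 2) * (- I 3 4))) = ln (\<kappa>\<^sup>2) + ln ((- I 1 2) * (- I 3 4))"
    using neg \<open>\<kappa> > 0\<close> by (intro ln_mult_pos) (auto simp: mult_neg_neg)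
  moreover have "ln ((- I 1 2) * (- I 3 4)) = ln (- I 1 2) + ln (- I 3 4)"
    using neg by (intro ln_mult_pos) auto
  moreover have "ln (\<kappa>\<^sup>2) = 2 * ln \<kappa>"
    using \<open>\<kappa> > 0\<close> by (simp add: ln_realpow)
  ultimately have "ln (- I 1 4) + ln (- I 2 3) = 2 * ln \<kappa> + (ln (- I 1 2) + ln (- I 3 4))"
    by (simp only:)
  \<comment> \<open>The offset is the same for all pairs and appears twice with each sign, so the
    cutoff drops out.\<close>
  moreover have "ln (- (1/4) * I i j / \<delta>\<^sup>2) = ln (- I i j) - ln (4 * \<delta>\<^sup>2)" if "I i j < 0" for i j
    using that \<open>\<delta> > 0\<close> ln_div[of "- I i j" "4 * \<delta>\<^sup>2"] by simp
  ultimately show ?thesis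
    using neg by simp
qed

theorem mainTheorem3:
  fixes d :: nat and L G \<delta> :: real
    and V p :: "nat \<Rightarrow> int \<Rightarrow> real" and x :: "nat \<Rightarrow> nat \<Rightarrow> real"
  assumes "even d" and "d \<ge> 2"
    and "L > 0" and "G > 0" and "\<delta> > 0"
    and "string_segment d L V p"
    and "\<forall>i\<in>{1..4}. minus_comp (p i) \<noteq> 0"
    and "causality_conditions d L V p"
  defines "x \<equiv> \<lambda>i. boundary_point L (p i)"
  shows "S_uni d L G \<delta> (x 1) (x 4) + S_uni d L G \<delta> (x 2) (x 3)
         - S_uni d L G \<delta> (x 1) (x 2) - S_uni d L G \<delta> (x 3) (x 4)
       = (-1) ^ ((d - 2) div 2)
         * (ball_volume (d - 2) L * lorentzian_area d (world_sheet d L (V 1) (p 1) (p 4)))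
         / (4 * G * L)"
proof -
  define m where "m = ip d (p 1) (p 4) / 2"
  define \<kappa> where "\<kappa> = 1 - m / L\<^sup>2"
  have frame: "light_cone_frame d L (V 1) (p 1) (p 4)"
    using assms(6) by (simp add: string_segment_def light_cone_frame_def AdS_def null_vectors_def)
  have "m < 0"
    using assms(8) by (simp add: m_def causality_conditions_def)
  then have "m / L\<^sup>2 < 0"
    using \<open>L > 0\<close> by (simp add: divide_neg_pos)
  then have "\<kappa> > 0"
    by (simp add: \<kappa>_def)
  have "L\<^sup>2 - m \<noteq> 0"
    using \<open>m < 0\<close> by (smt (verit) zero_le_power2)
  note edges = ip_world_sheet_edges[OF \<open>L > 0\<close> frame, folded m_def, OF this, folded \<kappa>_def]
  have p23: "p 2 = (\<lambda>k. world_sheet d L (V 1) (p 1) (p 4) 1 1 k - world_sheet d L (V 1) (p 1) (p 4) 1 0 k)"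
    "p 3 = (\<lambda>k. world_sheet d L (V 1) (p 1) (p 4) 1 1 k - world_sheet d L (V 1) (p 1) (p 4) 0 1 k)"
    using assms(6) by (simp_all add: string_segment_def)
  have null: "ip d (p i) (p i) = 0 \<and> minus_comp (p i) \<noteq> 0" if "i \<in> {1..4}" for i
  proof -
    have "i = 1 \<or> i = 2 \<or> i = 3 \<or> i = 4"
      using that by auto
    then have "ip d (p i) (p i) = 0"
      using frame edges(1,2)[folded p23] by (auto simp: light_cone_frame_def)
    then show ?thesis
      using that assms(7) by blast
  qed
  have neg: "interval_sq d (x 1) (x 2) < 0" "interval_sq d (x 2) (x 3) < 0"
    "interval_sq d (x 3) (x 4) < 0" "interval_sq d (x 1) (x 4) < 0"
    using assms(8) by (simp_all add: causality_conditions_def x_def)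
  \<comment> \<open>This form resolves the truncated differences: \<open>d - 2\<close> is
    \<open>2 * k\<close> and \<open>d - 1\<close> is \<open>2 * k + 1\<close>.\<close>
  obtain k where d: "d = 2 * k + 2"
  proof -
    obtain j where "d = 2 * j"
      using \<open>even d\<close> by (rule evenE)
    with \<open>d \<ge> 2\<close> have "d = 2 * (j - 1) + 2"
      by simp
    then show thesis
      by (rule that)
  qed
  define C where "C = (- 2 * pi) ^ k * L ^ (2 * k + 1) / (4 * G * (2 ^ k * fact k))"
  have S: "S_uni d L G \<delta> (x i) (x j) = C * ln (- (1/4) * interval_sq d (x i) (x j) / \<delta>\<^sup>2)" for i j
    by (simp add: S_uni_def d C_def double_fact_even)
  have "S_uni d L G \<delta> (x 1) (x 4) + S_uni d L G \<delta> (x 2) (x 3)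
      - S_uni d L G \<delta> (x 1) (x 2) - S_uni d L G \<delta> (x 3) (x 4) = C * (2 * ln \<kappa>)"
    unfolding S right_diff_distrib[symmetric] distrib_left[symmetric] unfolding x_def
    using ln_interval_sq_cross_ratio[of d \<delta> \<kappa> p L, OF _ \<open>\<delta> > 0\<close> \<open>\<kappa> > 0\<close> null neg[unfolded x_def]
        edges(3-5)[folded p23]] \<open>d \<ge> 2\<close> by simp
  also have "\<dots> = (-1) ^ k * (ball_volume (2 * k) L * (2 * L\<^sup>2 * ln \<kappa>)) / (4 * G * L)"
  proof -
    \<comment> \<open>The power of \<open>2\<close> cancels against the double factorial, leaving
      the sign and the ball volume.\<close>
    have "(- 2 * pi) ^ k = (-1) ^ k * (2 ^ k * pi ^ k)"
      using power_mult_distrib[of "-1" "2 * pi" k] by (simp add: power_mult_distrib)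
    then have "C = ((-1) ^ k * (pi ^ k * L ^ (2 * k) / fact k)) * L / (4 * G)"
      using \<open>G > 0\<close> by (simp add: C_def divide_simps)
    then have "C = ((-1) ^ k * ball_volume (2 * k) L) * L / (4 * G)"
      by (simp only: ball_volume_even[OF \<open>L > 0\<close>])
    then show ?thesis
      using \<open>L > 0\<close> by (simp add: power2_eq_square)
  qed
  also have "2 * L\<^sup>2 * ln \<kappa> = lorentzian_area d (world_sheet d L (V 1) (p 1) (p 4))"
    using lorentzian_area_world_sheet[OF \<open>L > 0\<close> frame] \<open>m < 0\<close> by (simp add: \<kappa>_def m_def)
  finally show ?thesis
    by (simp add: d)
qed

end
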